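(* For every integer $k \geq 1$ and every $p \in (0,1)$, the set $\mathbf{H}_{k,p}$ contains no infinite strictly increasing sequence.
   Context: A hypergraph $\mathcal{H}$ consists of a vertex set $V(\mathcal{H})$ and a set of finite subsets of $V(\mathcal{H})$ (hyperedges). A set of vertices is independent if it contains no hyperedge; $\mathcal{I}(\mathcal{H})$ is the set of independent sets. The rank $r(\mathcal{H})$ is the supremum of hyperedge sizes. For a finite hypergraph on $n$ vertices, $\mathrm{id}_p(\mathcal{H}) = \sum_{I \in \mathcal{I}(\mathcal{H})} p^{|I|}(1-p)^{n-|I|}$. For a countable hypergraph $\mathcal{H}$, a chain is a sequence $(\mathcal{C}_n)$ of finite hypergraphs, each an induced subhypergraph of the next, whose vertex sets and edge sets have unions $V(\mathcal{H})$ and $E(\mathcal{H})$; $\mathrm{id}_p(\mathcal{H}) = \lim_n \mathrm{id}_p(\mathcal{C}_n)$ (independent of the chain). $\mathbf{H}_{k,p} = \{\mathrm{id}_p(\mathcal{H}) \mid \mathcal{H} \text{ countable (possibly finite) hypergraph with } r(\mathcal{H}) \le k\}$. *)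

theory Defs
  imports Complex_Main "HOL-Library.Extended_Nat" "HOL-Library.Countable_Set"
begin

record 'v hypergraph =
  verts :: "'v set"
  edges :: "'v set set"

text \<open>The empty set is allowed as a hyperedge, and so is the empty vertex set.\<close>

definition hypergraph :: "'v hypergraph \<Rightarrow> bool" where
  "hypergraph H \<longleftrightarrow> (\<forall>e\<in>edges H. e \<subseteq> verts H \<and> finite e)"

definition countable_hypergraph :: "'v hypergraph \<Rightarrow> bool" where
  "countable_hypergraph H \<longleftrightarrow> hypergraph H \<and> countable (verts H)"

definition indep_sets :: "'v hypergraph \<Rightarrow> 'v set set" where
  "indep_sets H = {I. I \<subseteq> verts H \<and> \<not> (\<exists>e\<in>edges H. e \<subseteq> I)}"

text \<open>With values in \<^typ>\<open>enat\<close>, the supremum may be infinite, and it is 0 if there are no edges.\<close>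

definition hypergraph_rank :: "'v hypergraph \<Rightarrow> enat" where
  "hypergraph_rank H = (SUP e\<in>edges H. enat (card e))"

definition fin_id :: "real \<Rightarrow> 'v hypergraph \<Rightarrow> real" where
  "fin_id p H = (\<Sum>I\<in>indep_sets H. p ^ card I * (1 - p) ^ (card (verts H) - card I))"

definition induced_subhypergraph :: "'v hypergraph \<Rightarrow> 'v hypergraph \<Rightarrow> bool" where
  "induced_subhypergraph A B \<longleftrightarrow>
     verts A \<subseteq> verts B \<and> edges A = {e \<in> edges B. e \<subseteq> verts A}"

definition hypergraph_chain :: "(nat \<Rightarrow> 'v hypergraph) \<Rightarrow> 'v hypergraph \<Rightarrow> bool" where
  "hypergraph_chain C H \<longleftrightarrow>
     (\<forall>n. hypergraph (C n) \<and> finite (verts (C n)) \<and> induced_subhypergraph (C n) (C (Suc n)))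
     \<and> (\<Union>n. verts (C n)) = verts H \<and> (\<Union>n. edges (C n)) = edges H"

text \<open>
  For a countable hypergraph and \<^term>\<open>0 \<le> p \<and> p \<le> 1\<close>, a chain exists and the limit below
  exists and is the same for all chains (\<open>ex_hypergraph_chain\<close>, \<open>idp_tendsto\<close>); for
  a finite hypergraph it is the finite sum (\<open>idp_finite\<close>).
\<close>

definition idp :: "real \<Rightarrow> 'v hypergraph \<Rightarrow> real" where
  "idp p H = (THE L. \<forall>C. hypergraph_chain C H \<longrightarrow> (\<lambda>n. fin_id p (C n)) \<longlonglongrightarrow> L)"

text \<open>
  Vertices are taken from \<^typ>\<open>nat\<close>; by \<open>idp_in_HH\<close> this
  covers countable hypergraphs over every vertex type.
\<close>

definition HH :: "nat \<Rightarrow> real \<Rightarrow> real set" where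
  "HH k p = {idp p H | H :: nat hypergraph. countable_hypergraph H \<and> hypergraph_rank H \<le> enat k}"


subsection \<open>The limit is well defined\<close>

definition induced :: "'v hypergraph \<Rightarrow> 'v set \<Rightarrow> 'v hypergraph" where
  "induced H W = \<lparr>verts = W, edges = {e \<in> edges H. e \<subseteq> W}\<rparr>"

lemma induced_simps [simp]:
  "verts (induced H W) = W" "edges (induced H W) = {e \<in> edges H. e \<subseteq> W}"
  by (simp_all add: induced_def)

lemma ex_hypergraph_chain:
  assumes "countable_hypergraph H"
  shows "\<exists>C. hypergraph_chain C H"
proof -
  let ?V = "verts H"
  let ?f = "to_nat_on ?V"
  define W where "W n = {v \<in> ?V. ?f v < n}" for n
  have inj: "inj_on ?f ?V"
    using assms by (auto simp: countable_hypergraph_def)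
  have finW: "finite (W n)" for n
  proof (rule finite_imageD)
    show "finite (?f ` W n)"
      by (rule finite_subset[of _ "{..<n}"]) (auto simp: W_def)
    show "inj_on ?f (W n)"
      by (rule inj_on_subset[OF inj]) (auto simp: W_def)
  qed
  have cover: "\<exists>n. e \<subseteq> W n" if "finite e" "e \<subseteq> ?V" for e
  proof -
    from that obtain n where "\<forall>x\<in>?f ` e. x < n"
      by (metis finite_imageI finite_nat_set_iff_bounded)
    then show ?thesis using that by (auto simp: W_def intro!: exI[of _ n])
  qed
  have "hypergraph_chain (\<lambda>n. induced H (W n)) H"
    unfolding hypergraph_chain_def
  proof (intro conjI allI)
    fix n
    show "hypergraph (induced H (W n))"
      using assms by (auto simp: hypergraph_def countable_hypergraph_def)
    show "finite (verts (induced H (W n)))" using finW by simp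
    show "induced_subhypergraph (induced H (W n)) (induced H (W (Suc n)))"
      by (auto simp: induced_subhypergraph_def W_def)
  next
    show "(\<Union>n. verts (induced H (W n))) = ?V" by (auto simp: W_def)
    show "(\<Union>n. edges (induced H (W n))) = edges H"
      using assms cover by (auto simp: hypergraph_def countable_hypergraph_def)
  qed
  then show ?thesis by blast
qed

lemma chain_mono:
  assumes "hypergraph_chain C H" "m \<le> n"
  shows "induced_subhypergraph (C m) (C n)"
  using assms(2)
proof (induction rule: dec_induct)
  case base
  have "hypergraph (C m)" using assms(1) by (simp add: hypergraph_chain_def)
  then show ?case by (auto simp: induced_subhypergraph_def hypergraph_def)
next
  case (step n)
  have "induced_subhypergraph (C n) (C (Suc n))"
    using assms(1) by (simp add: hypergraph_chain_def)
  with step.IH show ?case by (auto simp: induced_subhypergraph_def)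
qed

lemma chain_restrict:
  assumes "hypergraph_chain C H"
  shows "C n = induced H (verts (C n))"
proof -
  have "e \<in> edges (C n)" if "e \<in> edges H" "e \<subseteq> verts (C n)" for e
  proof -
    have "(\<Union>n. edges (C n)) = edges H"
      using assms unfolding hypergraph_chain_def by simp
    with that(1) obtain m where m: "e \<in> edges (C m)" by auto
    show ?thesis
    proof (cases "m \<le> n")
      case True
      from chain_mono[OF assms this] m that(2) show ?thesis
        by (simp add: induced_subhypergraph_def)
    next
      case False
      then have "n \<le> m" by simp
      from chain_mono[OF assms this] m that(2) show ?thesis
        by (simp add: induced_subhypergraph_def)
    qed
  qed
  moreover have "e \<in> edges H \<and> e \<subseteq> verts (C n)" if "e \<in> edges (C n)" for e
  proof -
    have "hypergraph (C n)" and "(\<Union>n. edges (C n)) = edges H"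
      using assms unfolding hypergraph_chain_def by simp_all
    with that show ?thesis unfolding hypergraph_def by blast
  qed
  ultimately have "edges (C n) = {e \<in> edges H. e \<subseteq> verts (C n)}" by blast
  then show ?thesis by (simp add: induced_def)
qed

lemma fin_id_nonneg:
  assumes "0 \<le> p" "p \<le> 1"
  shows "0 \<le> fin_id p H"
  unfolding fin_id_def using assms by (intro sum_nonneg mult_nonneg_nonneg) auto

lemma fin_id_insert_le:
  assumes "finite W" "v \<notin> W" and p: "0 \<le> p" "p \<le> 1"
  shows "fin_id p (induced H (insert v W)) \<le> fin_id p (induced H W)"
proof -
  let ?S = "indep_sets (induced H W)" and ?T = "indep_sets (induced H (insert v W))"
  let ?g = "\<lambda>I. p ^ card I * (1 - p) ^ (Suc (card W) - card I)"
  have S: "I \<subseteq> W" if "I \<in> ?S" for I using that by (auto simp: indep_sets_def)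
  have "finite ?S" by (rule finite_subset[of _ "Pow W"]) (use S assms(1) in auto)
  have sub: "?T \<subseteq> ?S \<union> insert v ` ?S"
  proof
    fix I assume I: "I \<in> ?T"
    then have IS: "I - {v} \<in> ?S" by (auto simp: indep_sets_def)
    show "I \<in> ?S \<union> insert v ` ?S"
    proof (cases "v \<in> I")
      case True
      then have "I = insert v (I - {v})" by auto
      with IS show ?thesis by blast
    next
      case False
      with IS show ?thesis by simp
    qed
  qed
  have disj: "?S \<inter> insert v ` ?S = {}" using S assms(2) by blast
  have inj: "inj_on (insert v) ?S"
    by (rule inj_onI) (metis S assms(2) insert_ident subsetD)
  have "fin_id p (induced H (insert v W)) = sum ?g ?T"
    using assms by (simp add: fin_id_def)
  also have "\<dots> \<le> sum ?g (?S \<union> insert v ` ?S)"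
    using \<open>finite ?S\<close> sub p by (intro sum_mono2) auto
  also have "\<dots> = sum ?g ?S + sum (\<lambda>I. ?g (insert v I)) ?S"
    using \<open>finite ?S\<close> disj inj by (simp add: sum.union_disjoint sum.reindex)
  also have "\<dots> = (\<Sum>I\<in>?S. ?g I + ?g (insert v I))"
    by (simp add: sum.distrib)
  also have "\<dots> = fin_id p (induced H W)"
    unfolding fin_id_def
  proof (rule sum.cong)
    fix I assume "I \<in> ?S"
    then have "I \<subseteq> W" by (rule S)
    then have fin: "finite I" and "v \<notin> I" and le: "card I \<le> card W"
      using assms finite_subset card_mono by auto
    then have "card (insert v I) = Suc (card I)" by simp
    then show "?g I + ?g (insert v I)
        = p ^ card I * (1 - p) ^ (card (verts (induced H W)) - card I)"
      using le by (simp add: Suc_diff_le algebra_simps)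
  qed simp
  finally show ?thesis .
qed

lemma fin_id_antimono:
  assumes "finite W'" "W \<subseteq> W'" and p: "0 \<le> p" "p \<le> 1"
  shows "fin_id p (induced H W') \<le> fin_id p (induced H W)"
proof -
  have fin: "finite W"
    using assms(2,1) by (rule finite_subset)
  have "fin_id p (induced H (W \<union> D)) \<le> fin_id p (induced H W)"
    if "D \<subseteq> W' - W" "finite D" for D
    using that(2,1)
  proof (induction D)
    case (insert v D)
    have "fin_id p (induced H (insert v (W \<union> D))) \<le> fin_id p (induced H (W \<union> D))"
      using insert assms fin p by (intro fin_id_insert_le) auto
    with insert show ?case by simp
  qed simp
  from this[of "W' - W"] assms show ?thesis by (simp add: Un_absorb1)
qed

lemma chain_tendsto_INF:
  assumes C: "hypergraph_chain C H" and p: "0 \<le> p" "p \<le> 1"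
  shows "(\<lambda>n. fin_id p (C n)) \<longlonglongrightarrow>
    (INF W\<in>{W. finite W \<and> W \<subseteq> verts H}. fin_id p (induced H W))"
    (is "_ \<longlonglongrightarrow> ?L")
proof -
  let ?F = "{W. finite W \<and> W \<subseteq> verts H}" and ?f = "\<lambda>W. fin_id p (induced H W)"
  have fin: "finite (verts (C n))" and sub: "verts (C n) \<subseteq> verts H" for n
    using C unfolding hypergraph_chain_def by auto
  have eq: "fin_id p (C n) = ?f (verts (C n))" for n
    using chain_restrict[OF C, of n] by metis
  have mono: "verts (C m) \<subseteq> verts (C n)" if "m \<le> n" for m n
    using chain_mono[OF C that] by (simp add: induced_subhypergraph_def)
  have bdd: "bdd_below (?f ` ?F)"
    by (rule bdd_belowI2[of _ 0]) (use fin_id_nonneg p in auto)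
  have cover: "\<exists>n. W \<subseteq> verts (C n)" if "finite W" "W \<subseteq> verts H" for W
    using that
  proof (induction W)
    case (insert v W)
    then obtain n where n: "W \<subseteq> verts (C n)" by auto
    have "(\<Union>n. verts (C n)) = verts H"
      using C unfolding hypergraph_chain_def by simp
    with insert.prems obtain m where "v \<in> verts (C m)" by auto
    with n have "insert v W \<subseteq> verts (C (max m n))"
      using mono[of n "max m n"] mono[of m "max m n"] by auto
    then show ?case by blast
  qed simp
  show ?thesis
  proof (rule decreasing_tendsto)
    show "\<forall>\<^sub>F n in sequentially. ?L \<le> fin_id p (C n)"
      by (intro always_eventually allI, subst eq, rule cINF_lower[OF bdd]) (use fin sub in auto)
  next
    fix x assume "?L < x"
    then obtain W where W: "finite W" "W \<subseteq> verts H" "?f W < x"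
      using cINF_less_iff[OF _ bdd, of x] by auto
    from cover[OF W(1,2)] obtain N where N: "W \<subseteq> verts (C N)" by blast
    have "fin_id p (C n) < x" if "n \<ge> N" for n
    proof -
      have "W \<subseteq> verts (C n)" using N mono[OF that] by blast
      then have "?f (verts (C n)) \<le> ?f W" by (rule fin_id_antimono[OF fin _ p])
      with W(3) eq[of n] show ?thesis by linarith
    qed
    then show "\<forall>\<^sub>F n in sequentially. fin_id p (C n) < x"
      by (auto simp: eventually_sequentially)
  qed
qed

lemma idp_tendsto:
  assumes H: "countable_hypergraph H" and C: "hypergraph_chain C H" and p: "0 \<le> p" "p \<le> 1"
  shows "(\<lambda>n. fin_id p (C n)) \<longlonglongrightarrow> idp p H"
proof -
  have "\<exists>!L. \<forall>C. hypergraph_chain C H \<longrightarrow> (\<lambda>n. fin_id p (C n)) \<longlonglongrightarrow> L"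
    using chain_tendsto_INF[OF _ p] C LIMSEQ_unique by blast
  then have "\<forall>C. hypergraph_chain C H \<longrightarrow> (\<lambda>n. fin_id p (C n)) \<longlonglongrightarrow> idp p H"
    unfolding idp_def by (rule theI')
  then show ?thesis using C by blast
qed

lemma idp_finite:
  assumes H: "hypergraph H" "finite (verts H)" and p: "0 \<le> p" "p \<le> 1"
  shows "idp p H = fin_id p H"
proof -
  have "hypergraph_chain (\<lambda>_. H) H"
    using H by (auto simp: hypergraph_chain_def induced_subhypergraph_def hypergraph_def)
  moreover have "countable_hypergraph H"
    using H by (simp add: countable_hypergraph_def countable_finite)
  ultimately have "(\<lambda>_. fin_id p H) \<longlonglongrightarrow> idp p H"
    using idp_tendsto p by blast
  then show ?thesis by (simp add: LIMSEQ_const_iff)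
qed


subsection \<open>Invariance under isomorphism\<close>

definition map_hypergraph :: "('v \<Rightarrow> 'w) \<Rightarrow> 'v hypergraph \<Rightarrow> 'w hypergraph" where
  "map_hypergraph f H = \<lparr>verts = f ` verts H, edges = (`) f ` edges H\<rparr>"

lemma map_hypergraph_simps [simp]:
  "verts (map_hypergraph f H) = f ` verts H" "edges (map_hypergraph f H) = (`) f ` edges H"
  by (simp_all add: map_hypergraph_def)

lemma hypergraph_map: "hypergraph H \<Longrightarrow> hypergraph (map_hypergraph f H)"
  by (fastforce simp: hypergraph_def)

lemma inj_on_image_subset_iff:
  assumes "inj_on f V" "A \<subseteq> V" "B \<subseteq> V"
  shows "f ` A \<subseteq> f ` B \<longleftrightarrow> A \<subseteq> B"
  using assms by (metis image_mono inv_into_image_cancel)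

lemma fin_id_map:
  assumes H: "hypergraph H" and inj: "inj_on f (verts H)"
  shows "fin_id p (map_hypergraph f H) = fin_id p H"
proof -
  have e: "f ` e \<subseteq> f ` I \<longleftrightarrow> e \<subseteq> I" if "e \<in> edges H" "I \<subseteq> verts H" for e I
    using H that inj by (intro inj_on_image_subset_iff[OF inj]) (auto simp: hypergraph_def)
  have img: "indep_sets (map_hypergraph f H) = (`) f ` indep_sets H"
  proof (intro equalityI subsetI)
    fix J assume J: "J \<in> indep_sets (map_hypergraph f H)"
    then obtain I where I: "I \<subseteq> verts H" "J = f ` I"
      by (auto simp: indep_sets_def subset_image_iff)
    with J e have "I \<in> indep_sets H" by (auto simp: indep_sets_def)
    with I show "J \<in> (`) f ` indep_sets H" by blast
  next
    fix J assume "J \<in> (`) f ` indep_sets H"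
    with e show "J \<in> indep_sets (map_hypergraph f H)" by (auto simp: indep_sets_def)
  qed
  have "inj_on ((`) f) (indep_sets H)"
    by (rule inj_on_subset[OF inj_on_image_Pow[OF inj]]) (auto simp: indep_sets_def)
  moreover have "card (f ` I) = card I" if "I \<in> indep_sets H" for I
    using that inj by (intro card_image inj_on_subset[OF inj]) (auto simp: indep_sets_def)
  ultimately show ?thesis
    by (simp add: fin_id_def img sum.reindex card_image[OF inj])
qed

lemma chain_map:
  assumes C: "hypergraph_chain C H" and inj: "inj_on f (verts H)"
  shows "hypergraph_chain (\<lambda>n. map_hypergraph f (C n)) (map_hypergraph f H)"
proof -
  have "induced_subhypergraph (map_hypergraph f (C n)) (map_hypergraph f (C (Suc n)))" for n
  proof -
    have ind: "induced_subhypergraph (C n) (C (Suc n))"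
      and hyp: "hypergraph (C (Suc n))" and sub: "verts (C (Suc n)) \<subseteq> verts H"
      using C unfolding hypergraph_chain_def by auto
    have "f ` e \<subseteq> f ` verts (C n) \<longleftrightarrow> e \<subseteq> verts (C n)" if "e \<in> edges (C (Suc n))" for e
      using ind hyp that sub
      by (intro inj_on_image_subset_iff[OF inj])
        (auto simp: hypergraph_def induced_subhypergraph_def)
    with ind show ?thesis by (auto simp: induced_subhypergraph_def)
  qed
  with C show ?thesis
    unfolding hypergraph_chain_def
    by (auto simp: hypergraph_map simp flip: image_UN)
qed

lemma idp_in_HH:
  fixes H :: "'v hypergraph"
  assumes H: "countable_hypergraph H" and r: "hypergraph_rank H \<le> enat k" and p: "0 \<le> p" "p \<le> 1"
  shows "idp p H \<in> HH k p"
proof -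
  let ?f = "to_nat_on (verts H)"
  let ?M = "map_hypergraph ?f H"
  have inj: "inj_on ?f (verts H)" using H by (auto simp: countable_hypergraph_def)
  from ex_hypergraph_chain[OF H] obtain C where C: "hypergraph_chain C H" by blast
  have M: "countable_hypergraph ?M"
    using H hypergraph_map by (auto simp: countable_hypergraph_def)
  have "fin_id p (map_hypergraph ?f (C n)) = fin_id p (C n)" for n
    using C unfolding hypergraph_chain_def
    by (intro fin_id_map inj_on_subset[OF inj]) auto
  then have "(\<lambda>n. fin_id p (C n)) \<longlonglongrightarrow> idp p ?M"
    using idp_tendsto[OF M chain_map[OF C inj] p] by simp
  then have "idp p ?M = idp p H"
    using idp_tendsto[OF H C p] LIMSEQ_unique by blast
  moreover have "hypergraph_rank ?M \<le> enat k"
  proof -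
    have "card (?f ` e) \<le> k" if "e \<in> edges H" for e
    proof -
      have "finite e" using H that by (simp add: countable_hypergraph_def hypergraph_def)
      moreover have "enat (card e) \<le> enat k"
        using r that unfolding hypergraph_rank_def by (meson SUP_upper order_trans)
      ultimately show ?thesis by (meson card_image_le enat_ord_simps(1) le_trans)
    qed
    then show ?thesis by (auto simp: hypergraph_rank_def intro!: SUP_least)
  qed
  ultimately show ?thesis using M unfolding HH_def by (auto intro!: exI[of _ ?M])
qed

end

theory Submission
  imports Defs
begin

text \<open>
  The proof is by induction on the rank \<open>k\<close>, showing that every sequence in \<open>HH k p\<close> has a
  nonincreasing subsequence. If \<open>idp p H\<close> is bounded below by a positive constant, then \<open>H\<close> has
  no large matching, as \<open>m\<close> disjoint edges force \<open>idp p H \<le> (1 - p ^ k) ^ m\<close>; so a bounded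
  number of vertices meets all edges of size \<open>k\<close>. Conditioning on the random
  set at these vertices writes \<open>idp p H\<close> as a convex combination, with a bounded number of
  terms and weights depending only on \<open>p\<close>, of elements of \<open>HH (k - 1) p\<close>, and
  nonincreasing subsequences can be extracted for all terms simultaneously.
\<close>

section \<open>Real sets without infinite increase, and their closure properties\<close>

text \<open>Equivalent to the absence of strictly increasing sequences, but in a form that allows
  repeated extraction of subsequences.\<close>

definition has_decseq_subseqs :: "real set \<Rightarrow> bool" where
  "has_decseq_subseqs X \<longleftrightarrow>
     (\<forall>f. range f \<subseteq> X \<longrightarrow> (\<exists>g::nat \<Rightarrow> nat. strict_mono g \<and> decseq (f \<circ> g)))"

lemma has_decseq_subseqs_subset:
  "has_decseq_subseqs Y \<Longrightarrow> X \<subseteq> Y \<Longrightarrow> has_decseq_subseqs X"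
  unfolding has_decseq_subseqs_def by (meson order_trans)

lemma has_decseq_subseqs_singleton: "has_decseq_subseqs {a}"
  unfolding has_decseq_subseqs_def
proof (intro allI impI)
  fix f :: "nat \<Rightarrow> real" assume "range f \<subseteq> {a}"
  then have "f n = a" for n by blast
  then have "decseq (f \<circ> id)" unfolding decseq_def o_def by (metis order_refl)
  then show "\<exists>g. strict_mono g \<and> decseq (f \<circ> g)" by (auto intro: strict_mono_id)
qed

lemma decseq_subseq_of_infinite:
  assumes X: "has_decseq_subseqs X" and inf: "infinite {n. f n \<in> X}"
  shows "\<exists>g::nat \<Rightarrow> nat. strict_mono g \<and> decseq (f \<circ> g)"
proof -
  obtain h :: "nat \<Rightarrow> nat" where h: "strict_mono h" "\<And>n. h n \<in> {n. f n \<in> X}"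
    using infinite_enumerate[OF inf] by blast
  then have "range (f \<circ> h) \<subseteq> X" by auto
  then obtain g :: "nat \<Rightarrow> nat" where "strict_mono g" "decseq ((f \<circ> h) \<circ> g)"
    using X unfolding has_decseq_subseqs_def by blast
  then show ?thesis
    using h(1) by (intro exI[of _ "h \<circ> g"]) (auto simp: o_assoc strict_mono_o)
qed

lemma has_decseq_subseqs_Un:
  assumes "has_decseq_subseqs X" "has_decseq_subseqs Y"
  shows "has_decseq_subseqs (X \<union> Y)"
  unfolding has_decseq_subseqs_def
proof (intro allI impI)
  fix f :: "nat \<Rightarrow> real" assume "range f \<subseteq> X \<union> Y"
  then have "{n. f n \<in> X} \<union> {n. f n \<in> Y} = UNIV" by auto
  then have "infinite {n. f n \<in> X} \<or> infinite {n. f n \<in> Y}"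
    by (metis finite_Un infinite_UNIV_nat)
  then show "\<exists>g. strict_mono g \<and> decseq (f \<circ> g)"
    using decseq_subseq_of_infinite assms by blast
qed

text \<open>Extract twice: passing to a further subsequence that suits \<open>v\<close> keeps
  \<open>u\<close> nonincreasing, and nonnegative coefficients preserve the order.\<close>

lemma has_decseq_subseqs_lincomb:
  assumes X: "has_decseq_subseqs X" and Y: "has_decseq_subseqs Y" and ab: "0 \<le> a" "0 \<le> b"
  shows "has_decseq_subseqs {a * x + b * y | x y. x \<in> X \<and> y \<in> Y}"
  unfolding has_decseq_subseqs_def
proof (intro allI impI)
  fix f :: "nat \<Rightarrow> real" assume "range f \<subseteq> {a * x + b * y | x y. x \<in> X \<and> y \<in> Y}"
  then have "\<forall>n. \<exists>x y. f n = a * x + b * y \<and> x \<in> X \<and> y \<in> Y" by blast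
  then obtain u v where uv: "\<And>n. f n = a * u n + b * v n" "\<And>n. u n \<in> X" "\<And>n. v n \<in> Y"
    by metis
  obtain g :: "nat \<Rightarrow> nat" where g: "strict_mono g" "decseq (u \<circ> g)"
    using X uv(2) unfolding has_decseq_subseqs_def by blast
  have "range (v \<circ> g) \<subseteq> Y" using uv(3) by auto
  then obtain h :: "nat \<Rightarrow> nat" where h: "strict_mono h" "decseq ((v \<circ> g) \<circ> h)"
    using Y unfolding has_decseq_subseqs_def by blast
  have "decseq (f \<circ> (g \<circ> h))"
    unfolding decseq_def
  proof (intro allI impI)
    fix m n :: nat assume "m \<le> n"
    then have "u (g (h n)) \<le> u (g (h m))" "v (g (h n)) \<le> v (g (h m))"
      using g(2) h by (auto simp: decseq_def strict_mono_less_eq)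
    then show "(f \<circ> (g \<circ> h)) n \<le> (f \<circ> (g \<circ> h)) m"
      using ab by (simp add: uv(1) add_mono mult_left_mono)
  qed
  then show "\<exists>g. strict_mono g \<and> decseq (f \<circ> g)"
    using g(1) h(1) strict_mono_o by blast
qed

text \<open>An increase among nonnegative reals reaches a positive value, above which a monotone
  sequence then stays. This allows values near 0, where no bounded cover is available, to be
  ignored.\<close>

lemma has_decseq_subseqs_if_bounded_away:
  assumes nonneg: "\<And>x. x \<in> X \<Longrightarrow> 0 \<le> x"
    and away: "\<And>c. 0 < c \<Longrightarrow> has_decseq_subseqs {x \<in> X. c \<le> x}"
  shows "has_decseq_subseqs X"
  unfolding has_decseq_subseqs_def
proof (intro allI impI)
  fix f :: "nat \<Rightarrow> real" assume f: "range f \<subseteq> X"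
  show "\<exists>g. strict_mono g \<and> decseq (f \<circ> g)"
  proof (cases "\<exists>c>0. infinite {n. f n \<in> {x \<in> X. c \<le> x}}")
    case True
    then show ?thesis using decseq_subseq_of_infinite away by blast
  next
    case False
    obtain g :: "nat \<Rightarrow> nat" where g: "strict_mono g" "monoseq (\<lambda>n. f (g n))"
      using seq_monosub by blast
    have "decseq (\<lambda>n. f (g n))"
    proof (rule ccontr)
      assume nd: "\<not> decseq (\<lambda>n. f (g n))"
      then have inc: "incseq (\<lambda>n. f (g n))" using g(2) by (auto simp: monoseq_iff)
      obtain m n where "m \<le> n" "f (g m) < f (g n)"
        using nd by (auto simp: decseq_def not_le)
      \<comment> \<open>The value \<open>f (g n)\<close> is the threshold \<open>c\<close> that
        contradicts the case assumption.\<close>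
      then have pos: "0 < f (g n)" using nonneg[of "f (g m)"] f by fastforce
      have "g ` {n..} \<subseteq> {i. f i \<in> {x \<in> X. f (g n) \<le> x}}"
        using f inc by (auto simp: incseq_def)
      moreover have "infinite (g ` {n..})"
        using g(1) by (metis finite_imageD infinite_Ici inj_on_subset strict_mono_imp_inj_on top_greatest)
      ultimately show False using False pos by (meson finite_subset)
    qed
    then show ?thesis using g(1) by (auto simp: o_def)
  qed
qed

section \<open>Chains from exhausting vertex sets, and bounds for the limit\<close>

lemma hypergraph_rank_le_iff:
  "hypergraph_rank H \<le> enat k \<longleftrightarrow> (\<forall>e\<in>edges H. card e \<le> k)"
  by (simp add: hypergraph_rank_def SUP_le_iff)

text \<open>Gives chains with prescribed vertex sets, so that a hypergraph, its contraction and its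
  deletion can be exhausted in step.\<close>

lemma hypergraph_chain_induced:
  assumes H: "hypergraph H" and fin: "\<And>n. finite (W n)" and inc: "\<And>n. W n \<subseteq> W (Suc n)"
    and un: "(\<Union>n. W n) = verts H"
  shows "hypergraph_chain (\<lambda>n. induced H (W n)) H"
proof -
  have mono: "W m \<subseteq> W n" if "m \<le> n" for m n
    using lift_Suc_mono_le[of W, OF inc that] .
  have cover: "\<exists>n. e \<subseteq> W n" if "finite e" "e \<subseteq> verts H" for e
    using that
  proof (induction e)
    case (insert v e)
    then obtain n m where "e \<subseteq> W n" "v \<in> W m" using un by blast
    then have "insert v e \<subseteq> W (max m n)"
      using mono[of n "max m n"] mono[of m "max m n"] by auto
    then show ?case by blast
  qed simp
  have "hypergraph (induced H (W n))" for n
    using H by (simp add: hypergraph_def)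
  moreover have "induced_subhypergraph (induced H (W n)) (induced H (W (Suc n)))" for n
    using inc[of n] by (auto simp: induced_subhypergraph_def)
  moreover have "(\<Union>n. edges (induced H (W n))) = edges H"
    using H cover by (auto simp: hypergraph_def)
  ultimately show ?thesis
    using fin un by (simp add: hypergraph_chain_def)
qed

text \<open>Every chain limit equals this infimum, so any finite \<open>W\<close> bounds
  \<open>idp p H\<close> from above without a choice of chain.\<close>

lemma idp_eq_INF:
  assumes H: "countable_hypergraph H" and p: "0 \<le> p" "p \<le> 1"
  shows "idp p H = (INF W\<in>{W. finite W \<and> W \<subseteq> verts H}. fin_id p (induced H W))"
  using ex_hypergraph_chain[OF H] chain_tendsto_INF[OF _ p] idp_tendsto[OF H _ p] LIMSEQ_unique
  by blast

lemma idp_nonneg: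
  assumes "countable_hypergraph H" and p: "0 \<le> p" "p \<le> 1"
  shows "0 \<le> idp p H"
  unfolding idp_eq_INF[OF assms] by (rule cINF_greatest) (use fin_id_nonneg[OF p] in auto)

lemma idp_le_fin_id_induced:
  assumes "countable_hypergraph H" "finite W" "W \<subseteq> verts H" and p: "0 \<le> p" "p \<le> 1"
  shows "idp p H \<le> fin_id p (induced H W)"
  unfolding idp_eq_INF[OF assms(1) p]
  by (rule cINF_lower, rule bdd_belowI2[of _ 0]) (use assms fin_id_nonneg[OF p] in auto)

text \<open>The weights are the terms in the expansion of the product of \<open>p + (1 - p)\<close>
  over \<open>W\<close>.\<close>

lemma sum_Pow_weights:
  fixes p :: "'a::comm_ring_1"
  assumes "finite W"
  shows "(\<Sum>I\<in>Pow W. p ^ card I * (1 - p) ^ (card W - card I)) = 1"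
proof -
  have "(\<Sum>I\<in>Pow W. p ^ card I * (1 - p) ^ (card W - card I))
      = (\<Sum>I\<in>Pow W. prod (\<lambda>_. p) I * prod (\<lambda>_. 1 - p) (W - I))"
    by (rule sum.cong) (use assms in \<open>auto simp: card_Diff_subset finite_subset\<close>)
  also have "\<dots> = (\<Prod>i\<in>W. p + (1 - p))"
    by (rule prod_add[OF assms, symmetric])
  finally show ?thesis by simp
qed

subsection \<open>Conditioning on a vertex\<close>

definition vertex_deletion :: "'v \<Rightarrow> 'v hypergraph \<Rightarrow> 'v hypergraph" where
  "vertex_deletion v H = \<lparr>verts = verts H - {v}, edges = {e \<in> edges H. v \<notin> e}\<rparr>"

text \<open>Edges avoiding \<open>v\<close> are kept: this is the hypergraph seen when \<open>v\<close> is in the random set.\<close>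

definition vertex_contraction :: "'v \<Rightarrow> 'v hypergraph \<Rightarrow> 'v hypergraph" where
  "vertex_contraction v H = \<lparr>verts = verts H - {v}, edges = (\<lambda>e. e - {v}) ` edges H\<rparr>"

lemma vertex_deletion_simps [simp]:
  "verts (vertex_deletion v H) = verts H - {v}"
  "edges (vertex_deletion v H) = {e \<in> edges H. v \<notin> e}"
  by (simp_all add: vertex_deletion_def)

lemma vertex_contraction_simps [simp]:
  "verts (vertex_contraction v H) = verts H - {v}"
  "edges (vertex_contraction v H) = (\<lambda>e. e - {v}) ` edges H"
  by (simp_all add: vertex_contraction_def)

lemma countable_hypergraph_vertex_deletion:
  "countable_hypergraph H \<Longrightarrow> countable_hypergraph (vertex_deletion v H)"
  by (auto simp: countable_hypergraph_def hypergraph_def)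

lemma countable_hypergraph_vertex_contraction:
  "countable_hypergraph H \<Longrightarrow> countable_hypergraph (vertex_contraction v H)"
  by (auto simp: countable_hypergraph_def hypergraph_def)

text \<open>Independent sets containing \<open>v\<close> correspond, by removing \<open>v\<close>,
  to those of the contraction; the others are those of the deletion. The vertex \<open>v\<close>
  contributes the factor \<open>p\<close> or \<open>1 - p\<close>.\<close>

lemma fin_id_induced_insert:
  assumes W: "finite W" "v \<notin> W"
  shows "fin_id p (induced H (insert v W)) =
    p * fin_id p (induced (vertex_contraction v H) W)
    + (1 - p) * fin_id p (induced (vertex_deletion v H) W)"
proof -
  let ?A = "indep_sets (induced (vertex_contraction v H) W)"
  let ?B = "indep_sets (induced (vertex_deletion v H) W)"
  let ?g = "\<lambda>I. p ^ card I * (1 - p) ^ (Suc (card W) - card I)"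
  have A: "I \<subseteq> W" if "I \<in> ?A" for I using that by (auto simp: indep_sets_def)
  have B: "I \<subseteq> W" if "I \<in> ?B" for I using that by (auto simp: indep_sets_def)
  have fin: "finite ?A" "finite ?B"
    using A B W by (auto intro!: finite_subset[of _ "Pow W"])
  have split: "indep_sets (induced H (insert v W)) = insert v ` ?A \<union> ?B"
  proof (intro equalityI subsetI)
    fix I assume I: "I \<in> indep_sets (induced H (insert v W))"
    show "I \<in> insert v ` ?A \<union> ?B"
    proof (cases "v \<in> I")
      case True
      with I have "I - {v} \<in> ?A" by (auto simp: indep_sets_def)
      with True show ?thesis by (metis UnI1 image_eqI insert_Diff)
    next
      case False
      with I have "I \<in> ?B" by (auto simp: indep_sets_def)
      then show ?thesis by simp
    qed
  next
    fix I assume "I \<in> insert v ` ?A \<union> ?B"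
    then consider J where "J \<in> ?A" "I = insert v J" | "I \<in> ?B" by blast
    then show "I \<in> indep_sets (induced H (insert v W))"
    proof cases
      case 1
      then have J: "J \<subseteq> W" and "\<not> (\<exists>e\<in>edges H. e - {v} \<subseteq> W \<and> e - {v} \<subseteq> J)"
        by (auto simp: indep_sets_def)
      \<comment> \<open>An edge inside \<open>insert v J\<close> has its trace
        \<open>e - {v}\<close> inside \<open>J\<close>, hence also inside \<open>W\<close>.\<close>
      then have "\<not> (\<exists>e\<in>edges H. e \<subseteq> insert v J)" by blast
      with J 1 show ?thesis by (auto simp: indep_sets_def)
    next
      case 2
      with W(2) show ?thesis by (auto simp: indep_sets_def)
    qed
  qed
  have disj: "insert v ` ?A \<inter> ?B = {}" using B W(2) by blast
  have inj: "inj_on (insert v) ?A"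
    by (rule inj_onI) (metis A W(2) insert_ident subsetD)
  have "fin_id p (induced H (insert v W)) = sum ?g (insert v ` ?A \<union> ?B)"
    using W by (simp add: fin_id_def split)
  also have "\<dots> = (\<Sum>I\<in>?A. ?g (insert v I)) + sum ?g ?B"
    using fin disj inj by (simp add: sum.union_disjoint sum.reindex)
  also have "(\<Sum>I\<in>?A. ?g (insert v I)) = p * fin_id p (induced (vertex_contraction v H) W)"
    unfolding fin_id_def sum_distrib_left
  proof (rule sum.cong)
    fix I assume "I \<in> ?A"
    then have "I \<subseteq> W" by (rule A)
    then have "card (insert v I) = Suc (card I)"
      using W finite_subset by (metis card_insert_disjoint subsetD)
    then show "?g (insert v I) = p * (p ^ card I *
        (1 - p) ^ (card (verts (induced (vertex_contraction v H) W)) - card I))" by simp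
  qed simp
  also have "sum ?g ?B = (1 - p) * fin_id p (induced (vertex_deletion v H) W)"
    unfolding fin_id_def sum_distrib_left
  proof (rule sum.cong)
    fix I assume "I \<in> ?B"
    then have "card I \<le> card W" using B W card_mono by blast
    then show "?g I = (1 - p) * (p ^ card I *
        (1 - p) ^ (card (verts (induced (vertex_deletion v H) W)) - card I))"
      by (simp add: Suc_diff_le)
  qed simp
  finally show ?thesis .
qed

text \<open>The finite identity passes to the limit along three chains built on the same sets
  \<open>W n\<close>.\<close>

lemma idp_vertex_decomp:
  assumes H: "countable_hypergraph H" and v: "v \<in> verts H" and p: "0 \<le> p" "p \<le> 1"
  shows "idp p H = p * idp p (vertex_contraction v H) + (1 - p) * idp p (vertex_deletion v H)"
proof -
  obtain C where C: "hypergraph_chain C H" using ex_hypergraph_chain[OF H] by blast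
  define W where "W n = verts (C n) - {v}" for n
  let ?A = "vertex_contraction v H" and ?B = "vertex_deletion v H"
  have fin: "finite (W n)" and inc: "W n \<subseteq> W (Suc n)" for n
    using C by (auto simp: W_def hypergraph_chain_def induced_subhypergraph_def)
  have "(\<Union>n. verts (C n)) = verts H" using C by (simp add: hypergraph_chain_def)
  then have un: "(\<Union>n. W n) = verts H - {v}" by (auto simp: W_def)
  have cA: "countable_hypergraph ?A" and cB: "countable_hypergraph ?B"
    using H by (rule countable_hypergraph_vertex_contraction countable_hypergraph_vertex_deletion)+
  have hA: "hypergraph ?A" and hB: "hypergraph ?B" and hH: "hypergraph H"
    using cA cB H by (simp_all add: countable_hypergraph_def)
  have "hypergraph_chain (\<lambda>n. induced ?A (W n)) ?A"
    by (rule hypergraph_chain_induced) (use hA fin inc un in simp_all)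
  note limA = idp_tendsto[OF cA this p]
  have "hypergraph_chain (\<lambda>n. induced ?B (W n)) ?B"
    by (rule hypergraph_chain_induced) (use hB fin inc un in simp_all)
  note limB = idp_tendsto[OF cB this p]
  \<comment> \<open>Inserting \<open>v\<close> at every stage, even where \<open>C n\<close> lacks
    it, makes the finite identity available for all \<open>n\<close>.\<close>
  have "hypergraph_chain (\<lambda>n. induced H (insert v (W n))) H"
    by (rule hypergraph_chain_induced) (use hH fin inc un v in auto)
  from idp_tendsto[OF H this p]
  have "(\<lambda>n. p * fin_id p (induced ?A (W n)) + (1 - p) * fin_id p (induced ?B (W n)))
      \<longlonglongrightarrow> idp p H"
    by (subst (asm) fin_id_induced_insert) (use fin in \<open>auto simp: W_def\<close>)
  moreover have "(\<lambda>n. p * fin_id p (induced ?A (W n)) + (1 - p) * fin_id p (induced ?B (W n)))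
      \<longlonglongrightarrow> p * idp p ?A + (1 - p) * idp p ?B"
    by (intro tendsto_intros limA limB)
  ultimately show ?thesis by (rule LIMSEQ_unique)
qed

subsection \<open>Disjoint edges\<close>

text \<open>An independent set meets \<open>W\<close> in an independent set and \<open>e\<close> in
  a proper subset. These two events concern disjoint vertex sets, so their probabilities multiply.
  Edges meeting both \<open>W\<close> and \<open>e\<close> are ignored, hence only an
  inequality.\<close>

lemma fin_id_induced_Un_edge:
  assumes W: "finite W" and e: "e \<in> edges H" "finite e" "e \<inter> W = {}" and p: "0 \<le> p" "p \<le> 1"
  shows "fin_id p (induced H (W \<union> e)) \<le> (1 - p ^ card e) * fin_id p (induced H W)"
proof -
  let ?S = "indep_sets (induced H W)" and ?T = "indep_sets (induced H (W \<union> e))"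
  let ?w = "\<lambda>U I. p ^ card I * (1 - p) ^ (card U - card I)"
  have S: "I \<subseteq> W" if "I \<in> ?S" for I using that by (auto simp: indep_sets_def)
  have fin: "finite ?S" by (rule finite_subset[of _ "Pow W"]) (use S W in auto)
  have sub: "?T \<subseteq> (\<lambda>(I, J). I \<union> J) ` (?S \<times> (Pow e - {e}))"
  proof
    fix I assume I: "I \<in> ?T"
    then have "I \<inter> W \<in> ?S" "I \<inter> e \<in> Pow e - {e}" "I = (I \<inter> W) \<union> (I \<inter> e)"
      using e by (auto simp: indep_sets_def)
    then show "I \<in> (\<lambda>(I, J). I \<union> J) ` (?S \<times> (Pow e - {e}))"
      by (metis (mono_tags, lifting) SigmaI case_prod_conv image_eqI)
  qed
  have inj: "inj_on (\<lambda>(I, J). I \<union> J) (?S \<times> (Pow e - {e}))"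
    by (rule inj_onI) (use S e(3) in \<open>auto; blast\<close>)
  have "fin_id p (induced H (W \<union> e)) = sum (?w (W \<union> e)) ?T"
    by (simp add: fin_id_def)
  also have "\<dots> \<le> sum (?w (W \<union> e)) ((\<lambda>(I, J). I \<union> J) ` (?S \<times> (Pow e - {e})))"
    by (rule sum_mono2) (use fin e sub p in auto)
  also have "\<dots> = (\<Sum>(I, J)\<in>?S \<times> (Pow e - {e}). ?w (W \<union> e) (I \<union> J))"
    using sum.reindex[OF inj, of "?w (W \<union> e)"] by (simp only: o_def case_prod_unfold)
  also have "\<dots> = (\<Sum>(I, J)\<in>?S \<times> (Pow e - {e}). ?w W I * ?w e J)"
  proof (rule sum.cong[OF refl], unfold split_paired_all case_prod_conv)
    fix I J assume IJ: "(I, J) \<in> ?S \<times> (Pow e - {e})"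
    then have J: "J \<subseteq> e" by simp
    from IJ have IW: "I \<subseteq> W" using S by blast
    have "card (I \<union> J) = card I + card J" "card (W \<union> e) = card W + card e"
      using IW J W e by (auto intro!: card_Un_disjoint intro: finite_subset)
    moreover have "card I \<le> card W" "card J \<le> card e"
      using IW J W e by (auto intro: card_mono)
    ultimately have "card (W \<union> e) - card (I \<union> J) = (card W - card I) + (card e - card J)"
      and "card (I \<union> J) = card I + card J" by simp_all
    then show "?w (W \<union> e) (I \<union> J) = ?w W I * ?w e J"
      by (simp add: power_add)
  qed
  also have "\<dots> = sum (?w W) ?S * sum (?w e) (Pow e - {e})"
    by (simp add: sum_product sum.cartesian_product)
  \<comment> \<open>The weights of all subsets of \<open>e\<close> sum to 1, and \<open>e\<close>
    itself has weight \<open>p ^ card e\<close>.\<close>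
  also have "sum (?w e) (Pow e - {e}) = 1 - p ^ card e"
    using sum.remove[of "Pow e" e "?w e"] sum_Pow_weights[OF e(2), of p] e(2) by simp
  also have "sum (?w W) ?S = fin_id p (induced H W)"
    by (simp add: fin_id_def)
  finally show ?thesis by (simp add: mult.commute)
qed

text \<open>Taking the union of a maximal matching by edges of size \<open>Suc k\<close>, stopped after \<open>m\<close> edges.\<close>

lemma cover_or_fin_id_small:
  assumes H: "hypergraph H" and r: "\<And>e. e \<in> edges H \<Longrightarrow> card e \<le> Suc k"
    and p: "0 \<le> p" "p \<le> 1"
  shows "\<exists>W \<subseteq> verts H. finite W \<and> card W \<le> m * Suc k \<and>
    ((\<forall>e\<in>edges H. card (e - W) \<le> k) \<or> fin_id p (induced H W) \<le> (1 - p ^ Suc k) ^ m)"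
proof (induction m)
  case 0
  \<comment> \<open>If the empty set is an edge, nothing is independent and the value is 0;
    otherwise it is 1.\<close>
  have "indep_sets (induced H {}) \<subseteq> {{}}" by (auto simp: indep_sets_def)
  then consider "indep_sets (induced H {}) = {}" | "indep_sets (induced H {}) = {{}}"
    by blast
  then have "fin_id p (induced H {}) \<le> 1"
    by cases (simp_all add: fin_id_def)
  then show ?case by (intro exI[of _ "{}"]) auto
next
  case (Suc m)
  then obtain W where W: "W \<subseteq> verts H" "finite W" "card W \<le> m * Suc k"
    and alt: "(\<forall>e\<in>edges H. card (e - W) \<le> k) \<or> fin_id p (induced H W) \<le> (1 - p ^ Suc k) ^ m"
    by blast
  show ?case
  proof (cases "\<forall>e\<in>edges H. card (e - W) \<le> k")
    case True
    with W show ?thesis by (intro exI[of _ W]) auto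
  next
    case False
    then obtain e where e: "e \<in> edges H" "k < card (e - W)" by (auto simp: not_le)
    have eV: "finite e" "e \<subseteq> verts H" using H e by (auto simp: hypergraph_def)
    \<comment> \<open>Having more than \<open>k\<close> vertices outside \<open>W\<close> but at
      most \<open>Suc k\<close> in total, \<open>e\<close> has exactly \<open>Suc k\<close> and
      misses \<open>W\<close>.\<close>
    have "card (e - W) \<le> card e" using eV by (simp add: card_mono)
    then have card: "card e = Suc k" "card (e - W) = card e" using e r[OF e(1)] by auto
    then have "e - W = e" using eV by (intro card_subset_eq) auto
    then have disj: "e \<inter> W = {}" by auto
    have q: "0 \<le> 1 - p ^ Suc k" using p power_le_one[of p "Suc k"] by simp
    have "fin_id p (induced H (W \<union> e)) \<le> (1 - p ^ Suc k) * fin_id p (induced H W)"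
      using fin_id_induced_Un_edge[OF W(2) e(1) eV(1) disj p] card by simp
    also have "\<dots> \<le> (1 - p ^ Suc k) * (1 - p ^ Suc k) ^ m"
      using alt False q by (intro mult_left_mono) auto
    finally have "fin_id p (induced H (W \<union> e)) \<le> (1 - p ^ Suc k) ^ Suc m" by simp
    moreover have "card (W \<union> e) \<le> Suc m * Suc k"
      using card_Un_le[of W e] W(3) card by simp
    ultimately show ?thesis using W eV by (intro exI[of _ "W \<union> e"]) auto
  qed
qed

section \<open>Bounded covers and the induction on the rank\<close>

text \<open>Bounding \<open>card (e - T)\<close> instead of asking \<open>T\<close> to meet the
  large edges gives a condition that survives contraction and deletion of a vertex of
  \<open>T\<close>; edges of \<open>H\<close> may have up to \<open>k + m\<close> vertices.\<close>

definition HH_cover :: "nat \<Rightarrow> nat \<Rightarrow> real \<Rightarrow> real set" where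
  "HH_cover k m p = {idp p H | (H :: nat hypergraph) T. countable_hypergraph H \<and> T \<subseteq> verts H
     \<and> finite T \<and> card T \<le> m \<and> (\<forall>e\<in>edges H. card (e - T) \<le> k)}"

lemma HH_cover_0: "HH_cover k 0 p \<subseteq> HH k p"
  by (auto simp: HH_cover_def HH_def hypergraph_rank_le_iff)

text \<open>Conditioning on some \<open>v\<close> in \<open>T\<close> uses up one cover vertex, as
  \<open>T - {v}\<close> serves both resulting hypergraphs. An empty \<open>T\<close> means rank at
  most \<open>k\<close> already.\<close>

lemma HH_cover_Suc:
  assumes p: "0 \<le> p" "p \<le> 1"
  shows "HH_cover k (Suc m) p
    \<subseteq> HH k p \<union> {p * x + (1 - p) * y | x y. x \<in> HH_cover k m p \<and> y \<in> HH_cover k m p}"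
proof
  fix z assume "z \<in> HH_cover k (Suc m) p"
  then obtain H :: "nat hypergraph" and T where z: "z = idp p H"
    and H: "countable_hypergraph H" and T: "T \<subseteq> verts H" "finite T" "card T \<le> Suc m"
    and small: "\<forall>e\<in>edges H. card (e - T) \<le> k"
    by (auto simp: HH_cover_def)
  show "z \<in> HH k p \<union> {p * x + (1 - p) * y | x y. x \<in> HH_cover k m p \<and> y \<in> HH_cover k m p}"
  proof (cases "T = {}")
    case True
    with small H z show ?thesis by (auto simp: HH_def hypergraph_rank_le_iff)
  next
    case False
    then obtain v where v: "v \<in> T" by blast
    let ?T = "T - {v}"
    have card: "card ?T \<le> m" using T v by (simp add: card_Diff_singleton)
    \<comment> \<open>The first equation is for contracted edges, the second for edges that the
      deletion keeps.\<close>
    have diff: "e - {v} - ?T = e - T" "v \<notin> e \<Longrightarrow> e - ?T = e - T" for e using v by auto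
    have "idp p (vertex_contraction v H) \<in> HH_cover k m p"
      unfolding HH_cover_def
      using T card small diff countable_hypergraph_vertex_contraction[OF H]
      by (fastforce intro!: exI[of _ "vertex_contraction v H"] exI[of _ ?T])
    moreover have "idp p (vertex_deletion v H) \<in> HH_cover k m p"
      unfolding HH_cover_def
      using T card small diff countable_hypergraph_vertex_deletion[OF H]
      by (fastforce intro!: exI[of _ "vertex_deletion v H"] exI[of _ ?T])
    ultimately show ?thesis
      using idp_vertex_decomp[OF H _ p, of v] T v z by blast
  qed
qed

text \<open>The weights \<open>p\<close> and \<open>1 - p\<close> are the same for all hypergraphs,
  so the closure under linear combinations applies at each of the \<open>m\<close> levels.\<close>

lemma has_decseq_subseqs_HH_cover:
  assumes HH: "has_decseq_subseqs (HH k p)" and p: "0 \<le> p" "p \<le> 1"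
  shows "has_decseq_subseqs (HH_cover k m p)"
proof (induction m)
  case 0
  show ?case by (rule has_decseq_subseqs_subset[OF HH HH_cover_0])
next
  case (Suc m)
  show ?case
    by (rule has_decseq_subseqs_subset[OF _ HH_cover_Suc[OF p]])
      (use HH Suc p in \<open>auto intro!: has_decseq_subseqs_Un has_decseq_subseqs_lincomb\<close>)
qed

text \<open>For a suitable number of disjoint edges of size \<open>Suc k\<close>, the matching bound
  falls below \<open>c\<close>, which leaves only the cover alternative.\<close>

lemma HH_bounded_away_subset_HH_cover:
  assumes p: "0 < p" "p < 1" and c: "0 < c"
  shows "\<exists>m. {x \<in> HH (Suc k) p. c \<le> x} \<subseteq> HH_cover k m p"
proof -
  have "0 < p ^ Suc k" using p by simp
  then obtain m where m: "(1 - p ^ Suc k) ^ m < c"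
    using real_arch_pow_inv[OF c, of "1 - p ^ Suc k"] by auto
  \<comment> \<open>The cover is a union of at most \<open>m\<close> edges with \<open>Suc k\<close>
    vertices each.\<close>
  have "x \<in> HH_cover k (m * Suc k) p" if x: "x \<in> HH (Suc k) p" "c \<le> x" for x
  proof -
    obtain H :: "nat hypergraph" where H: "countable_hypergraph H" and xH: "x = idp p H"
      and r: "\<And>e. e \<in> edges H \<Longrightarrow> card e \<le> Suc k"
      using x(1) by (auto simp: HH_def hypergraph_rank_le_iff)
    have "hypergraph H" using H by (simp add: countable_hypergraph_def)
    then obtain W where W: "W \<subseteq> verts H" "finite W" "card W \<le> m * Suc k"
      and alt: "(\<forall>e\<in>edges H. card (e - W) \<le> k) \<or> fin_id p (induced H W) \<le> (1 - p ^ Suc k) ^ m"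
      using cover_or_fin_id_small[of H k p m] r p by auto
    have "c \<le> fin_id p (induced H W)"
      using idp_le_fin_id_induced[OF H W(2,1), of p] p x xH by simp
    with m alt have "\<forall>e\<in>edges H. card (e - W) \<le> k" by linarith
    with H W xH show ?thesis by (auto simp: HH_cover_def)
  qed
  then show ?thesis by blast
qed

text \<open>The empty set is the only possible edge: with it no set is independent, without it every
  set is.\<close>

lemma HH_0_subset:
  assumes p: "0 \<le> p" "p \<le> 1"
  shows "HH 0 p \<subseteq> {0} \<union> {1}"
proof
  fix x assume "x \<in> HH 0 p"
  then obtain H :: "nat hypergraph" where H: "countable_hypergraph H" and x: "x = idp p H"
    and r: "\<And>e. e \<in> edges H \<Longrightarrow> card e = 0"
    by (auto simp: HH_def hypergraph_rank_le_iff)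
  have E: "e = {}" if "e \<in> edges H" for e
    using H r[OF that] that by (auto simp: countable_hypergraph_def hypergraph_def)
  \<comment> \<open>The value is the same for every finite \<open>W\<close>, so the infimum is over
    a single number.\<close>
  obtain a where a: "a = 0 \<or> a = 1" "\<And>W. finite W \<Longrightarrow> fin_id p (induced H W) = a"
  proof (cases "{} \<in> edges H")
    case True
    then have "fin_id p (induced H W) = 0" for W
      by (auto simp: fin_id_def indep_sets_def intro!: sum.neutral)
    then show ?thesis using that by blast
  next
    case False
    then have "edges H = {}" using E by blast
    then have "indep_sets (induced H W) = Pow W" for W
      by (auto simp: indep_sets_def)
    then have "fin_id p (induced H W) = 1" if "finite W" for W
      using sum_Pow_weights[OF that, of p] by (simp add: fin_id_def)
    then show ?thesis using that by blast
  qed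
  have "{} \<in> {W. finite W \<and> W \<subseteq> verts H}" by simp
  then have "(\<lambda>W. fin_id p (induced H W)) ` {W. finite W \<and> W \<subseteq> verts H} = {a}"
    using a(2) by force
  then have "idp p H = a" using idp_eq_INF[OF H p] by simp
  with a(1) x show "x \<in> {0} \<union> {1}" by auto
qed

text \<open>Starting the induction at rank 0 gives a base case with at most two values.\<close>

lemma has_decseq_subseqs_HH:
  assumes p: "0 < p" "p < 1"
  shows "has_decseq_subseqs (HH k p)"
proof (induction k)
  case 0
  show ?case
    by (rule has_decseq_subseqs_subset[OF _ HH_0_subset])
      (use p in \<open>auto intro: has_decseq_subseqs_Un[OF has_decseq_subseqs_singleton
        has_decseq_subseqs_singleton, simplified]\<close>)
next
  case (Suc k)
  show ?case
  proof (rule has_decseq_subseqs_if_bounded_away)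
    show "0 \<le> x" if "x \<in> HH (Suc k) p" for x
      using that p unfolding HH_def by (force intro!: idp_nonneg)
  next
    fix c :: real assume "0 < c"
    then obtain m where "{x \<in> HH (Suc k) p. c \<le> x} \<subseteq> HH_cover k m p"
      using HH_bounded_away_subset_HH_cover p by blast
    moreover have "has_decseq_subseqs (HH_cover k m p)"
      using has_decseq_subseqs_HH_cover[OF Suc] p by simp
    ultimately show "has_decseq_subseqs {x \<in> HH (Suc k) p. c \<le> x}"
      using has_decseq_subseqs_subset by blast
  qed
qed

theorem theorem3p3:
  fixes k :: nat and p :: real
  assumes "1 \<le> k" and "0 < p" and "p < 1"
  shows "\<not> (\<exists>x :: nat \<Rightarrow> real. strict_mono x \<and> (\<forall>n. x n \<in> HH k p))"
proof
  assume "\<exists>x :: nat \<Rightarrow> real. strict_mono x \<and> (\<forall>n. x n \<in> HH k p)"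
  then obtain x :: "nat \<Rightarrow> real" where x: "strict_mono x" "range x \<subseteq> HH k p" by blast
  then obtain g :: "nat \<Rightarrow> nat" where g: "strict_mono g" "decseq (x \<circ> g)"
    using has_decseq_subseqs_HH[OF assms(2,3)] unfolding has_decseq_subseqs_def by blast
  \<comment> \<open>Two terms of the nonincreasing subsequence already contradict strict
    increase.\<close>
  have "x (g 0) < x (g 1)" using x(1) g(1) by (simp add: strict_mono_less)
  moreover have "x (g 1) \<le> x (g 0)" using g(2) unfolding decseq_def by fastforce
  ultimately show False by simp
qed

end
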